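(* There exists a measurable exponent $p:[0,1]\to[1,+\infty)$ with $1<p_-\le p_+<\infty$ such that $1/p(\cdot)\in BLO^{1/\log}$ but the Hardy operator $T$, defined by $$Tf(x)=\frac1x\int_0^x f(t)\,dt,$$ is not bounded in $L^{p(\cdot)}[0,1]$.
   Context: For a measurable function (exponent) $p:[0,1]\to[1,+\infty)$, $L^{p(\cdot)}[0,1]$ is the set of measurable functions $f$ on $[0,1]$ such that $\int_{[0,1]}(|f(x)|/\lambda)^{p(x)}dx<\infty$ for some $\lambda>0$, with norm $\|f\|_{p(\cdot)}=\inf\{\lambda>0:\int_{[0,1]}(|f(x)|/\lambda)^{p(x)}dx\le 1\}$. Write $p_-=\operatorname{ess\,inf}_{x\in[0,1]}p(x)$ and $p_+=\operatorname{ess\,sup}_{x\in[0,1]}p(x)$. The operator $T$ is considered for $f\in L^{p(\cdot)}[0,1]$. For $f\in L^1[0,1]$ put $\eta(f,r)=\sup_{|Q|\le r}\left(f_Q-\operatorname{ess\,inf}_{x\in Q}f(x)\right)$ for $0<r\le 1$, where the supremum is over all intervals $Q\subset[0,1]$ (of positive length) with $|Q|\le r$, $|Q|$ is the Lebesgue measure of $Q$, and $f_Q=\frac{1}{|Q|}\int_Q f(x)\,dx$. We say $f\in BLO^{1/\log}$ if there is a constant $C>0$ such that $\eta(f,r)\le C/\log(e+1/r)$ for all $0<r\le1$. *)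

theory Defs
  imports "HOL-Analysis.Analysis" "HOL-Probability.Essential_Supremum"
begin

text \<open>Functions on \<open>[0,1]\<close> are represented by total functions \<open>real \<Rightarrow> real\<close>; only their
  restriction to \<open>{0..1}\<close> matters in every notion below.\<close>

definition exponent :: "(real \<Rightarrow> real) \<Rightarrow> bool" where
  "exponent p \<longleftrightarrow> p \<in> borel_measurable (lebesgue_on {0..1}) \<and> (\<forall>x\<in>{0..1}. 1 \<le> p x)"

text \<open>The library's \<^const>\<open>esssup\<close> needs values in a complete linear order, hence \<^typ>\<open>ereal\<close>.\<close>

definition ess_sup_on :: "real set \<Rightarrow> (real \<Rightarrow> real) \<Rightarrow> ereal" where
  "ess_sup_on A f = esssup (lebesgue_on A) (\<lambda>x. ereal (f x))"

definition ess_inf_on :: "real set \<Rightarrow> (real \<Rightarrow> real) \<Rightarrow> ereal" where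
  "ess_inf_on A f = - esssup (lebesgue_on A) (\<lambda>x. - ereal (f x))"

definition Lp_modular :: "(real \<Rightarrow> real) \<Rightarrow> (real \<Rightarrow> real) \<Rightarrow> real \<Rightarrow> ennreal" where
  "Lp_modular p f l = (\<integral>\<^sup>+x. ennreal ((\<bar>f x\<bar> / l) powr p x) \<partial>(lebesgue_on {0..1}))"

definition Lp_space :: "(real \<Rightarrow> real) \<Rightarrow> (real \<Rightarrow> real) set" where
  "Lp_space p = {f \<in> borel_measurable (lebesgue_on {0..1}). \<exists>l>0. Lp_modular p f l < \<infinity>}"

text \<open>Only meaningful on \<open>Lp_space p\<close>: elsewhere the infimum may be over the empty set.\<close>

definition Lp_norm :: "(real \<Rightarrow> real) \<Rightarrow> (real \<Rightarrow> real) \<Rightarrow> real" where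
  "Lp_norm p f = Inf {l. l > 0 \<and> Lp_modular p f l \<le> 1}"

definition bounded_in_Lp :: "(real \<Rightarrow> real) \<Rightarrow> ((real \<Rightarrow> real) \<Rightarrow> real \<Rightarrow> real) \<Rightarrow> bool" where
  "bounded_in_Lp p T \<longleftrightarrow>
     (\<exists>C. \<forall>f\<in>Lp_space p. T f \<in> Lp_space p \<and> Lp_norm p (T f) \<le> C * Lp_norm p f)"

definition hardy :: "(real \<Rightarrow> real) \<Rightarrow> real \<Rightarrow> real" where
  "hardy f x = 1 / x * (LINT t:{0..x}|lebesgue. f t)"

definition mean_on :: "real set \<Rightarrow> (real \<Rightarrow> real) \<Rightarrow> real" where
  "mean_on Q f = 1 / measure lebesgue Q * (LINT x:Q|lebesgue. f x)"

definition eta :: "(real \<Rightarrow> real) \<Rightarrow> real \<Rightarrow> ereal" where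
  "eta f r =
     (SUP Q \<in> {Q. is_interval Q \<and> Q \<subseteq> {0..1} \<and> 0 < measure lebesgue Q \<and> measure lebesgue Q \<le> r}.
        ereal (mean_on Q f) - ess_inf_on Q f)"

definition BLO_log :: "(real \<Rightarrow> real) set" where
  "BLO_log = {f. integrable (lebesgue_on {0..1}) f \<and>
     (\<exists>C>0. \<forall>r. 0 < r \<and> r \<le> 1 \<longrightarrow> eta f r \<le> ereal (C / ln (exp 1 + 1 / r)))}"

end

theory Submission
  imports Defs
begin

text \<open>
  The exponent is \<open>p = 4\<close> except for dips down to \<open>4/3\<close> at points \<open>8/2\<^sup>N\<close> with
  \<open>N = 1, 2, 4, 8, \<dots>\<close>; equivalently \<open>1/p = 1/4 + bump/2\<close>, where \<open>bump\<close> is a sum of spikes of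
  height 1 with disjoint supports. The spike at \<open>8/2\<^sup>N\<close> starts at distance \<open>2/2\<^sup>N\<close> and is
  constantly 1 within distance \<open>1/4\<^sup>N\<close>, growing roughly linearly in \<open>log(1/distance)\<close>
  in between. Functions of bounded lower oscillation may have upward logarithmic poles, and the
  decay \<open>1/log(1/r)\<close> still permits \<open>loglog\<close> poles; passing from scale \<open>2\<^sup>-\<^sup>N\<close> to scale
  \<open>4\<^sup>-\<^sup>N\<close> raises \<open>loglog\<close> by a constant, which is why a spike of fixed height fits in there
  for every \<open>N\<close>.

  \<^bold>\<open>Membership in \<open>BLO\<close>.\<close> A spike is the average of tents of height 1 and
  widths \<open>2\<^sup>-\<^sup>j\<close>, \<open>N \<le> j < 2N\<close>. The quantity \<open>f\<^sub>Q - inf\<^sub>Q f\<close> (called \<open>excess\<close>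
  below) is subadditive in \<open>f\<close>, and for one tent and an interval of length \<open>l\<close> it is at most
  \<open>min u (4/u)\<close> with \<open>u = 2\<^sup>jl\<close> (\<open>excess_tent_le\<close>): the tent has slope \<open>2\<^sup>j\<close> and mass
  \<open>O(2\<^sup>-\<^sup>j)\<close>. Along a doubling sequence of values of \<open>u\<close> these bounds add up to a constant
  (\<open>sum_min_doubling_le\<close>), so a spike has excess \<open>O(1/N)\<close>, and much less as long as
  \<open>4\<^sup>Nl\<close> is small. With \<open>L = ln(e + 1/l)\<close> this gives
  \<open>O(1/L) min (N/L) (4L/N)\<close>, which is again summed over the doubling sequence \<open>N = 2\<^sup>k\<close> and
  gives \<open>O(1/L)\<close> (\<open>excess_bump_le\<close>).

  \<^bold>\<open>Unboundedness.\<close> Put \<open>y = 2/2\<^sup>N\<close>. The indicator \<open>f\<close> of the bottom of the dip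
  at \<open>4y\<close> has support of length \<open>y\<^sup>2/2\<close>; there \<open>p = 4/3\<close>, so its norm is at most
  \<open>(y\<^sup>2)\<^bsup>3/4\<^esup> = y\<^bsup>3/2\<^esup>\<close>. On \<open>[5y, 6y]\<close> the exponent is 4 and
  \<open>Tf \<ge> y/12\<close>, so the norm of \<open>Tf\<close> is at least
  \<open>y\<^bsup>5/4\<^esup>/12\<close> (\<open>hardy_norm_gap\<close>). The quotient is at least \<open>y\<^bsup>-1/4\<^esup>/12\<close>, which is unbounded
  as \<open>y \<rightarrow> 0\<close>.
\<close>

section \<open>Means over a set and their excess over the infimum\<close>

lemma set_integrable_lebesgue_bounded:
  fixes f :: "real \<Rightarrow> real"
  assumes Q: "Q \<in> lmeasurable" and f: "f \<in> borel_measurable borel"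
    and B: "\<And>x. x \<in> Q \<Longrightarrow> \<bar>f x\<bar> \<le> B"
  shows "set_integrable lebesgue Q f"
proof -
  have "f \<in> borel_measurable lebesgue"
    using f by (simp add: measurable_completion)
  moreover have "Q \<in> sets lebesgue" "emeasure lebesgue Q < \<infinity>"
    using Q unfolding fmeasurable_def by blast+
  ultimately show ?thesis
    unfolding set_integrable_def
    using B by (intro integrableI_bounded_set_indicator[of Q lebesgue f B]) auto
qed

lemma mean_on_const:
  assumes "Q \<in> lmeasurable" "0 < measure lebesgue Q"
  shows "mean_on Q (\<lambda>x. a) = a"
  using assms unfolding mean_on_def 
  by (simp add: set_lebesgue_integral_def)

lemma mean_on_add:
  assumes "set_integrable lebesgue Q f" "set_integrable lebesgue Q g"
  shows "mean_on Q (\<lambda>x. f x + g x) = mean_on Q f + mean_on Q g"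
  using assms unfolding mean_on_def by (simp add: algebra_simps add_divide_distrib)

lemma mean_on_cmult: "mean_on Q (\<lambda>x. c * f x) = c * mean_on Q f"
  unfolding mean_on_def by simp

lemma mean_on_sum:
  assumes "\<And>i. i \<in> I \<Longrightarrow> set_integrable lebesgue Q (f i)"
  shows "mean_on Q (\<lambda>x. \<Sum>i\<in>I. f i x) = (\<Sum>i\<in>I. mean_on Q (f i))"
  using assms unfolding mean_on_def set_integrable_def set_lebesgue_integral_def
  by (simp add: scaleR_sum_right sum_divide_distrib sum_distrib_left Bochner_Integration.integral_sum)

lemma mean_on_mono:
  assumes "set_integrable lebesgue Q f" "set_integrable lebesgue Q g"
    and "\<And>x. x \<in> Q \<Longrightarrow> f x \<le> g x"
  shows "mean_on Q f \<le> mean_on Q g"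
  using set_integral_mono[OF assms] unfolding mean_on_def
  by (simp add: divide_right_mono)

text \<open>The true infimum replaces the essential one: it is no larger, and it needs no discussion of
  null sets.\<close>

definition excess :: "real set \<Rightarrow> (real \<Rightarrow> real) \<Rightarrow> real" where
  "excess Q f = mean_on Q f - Inf (f ` Q)"

text \<open>The mean is additive, and the infimum of a sum is at least the sum of the infima.\<close>

lemma excess_sum_le:
  fixes a :: "'i \<Rightarrow> real"
  assumes Q: "Q \<noteq> {}" and int: "\<And>i. i \<in> I \<Longrightarrow> set_integrable lebesgue Q (f i)"
    and bdd: "\<And>i. i \<in> I \<Longrightarrow> bdd_below (f i ` Q)" and a: "\<And>i. i \<in> I \<Longrightarrow> 0 \<le> a i"
  shows "excess Q (\<lambda>x. \<Sum>i\<in>I. a i * f i x) \<le> (\<Sum>i\<in>I. a i * excess Q (f i))"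
proof -
  have "mean_on Q (\<lambda>x. \<Sum>i\<in>I. a i * f i x) = (\<Sum>i\<in>I. a i * mean_on Q (f i))"
    using int by (subst mean_on_sum) (auto simp: mean_on_cmult)
  moreover have "(\<Sum>i\<in>I. a i * Inf (f i ` Q)) \<le> Inf ((\<lambda>x. \<Sum>i\<in>I. a i * f i x) ` Q)"
    using Q by (intro cInf_greatest)
      (auto intro!: sum_mono mult_left_mono a cInf_lower bdd)
  ultimately show ?thesis
    by (simp add: excess_def right_diff_distrib sum_subtractf)
qed

lemma ess_inf_on_ge:
  assumes "f \<in> borel_measurable (lebesgue_on Q)" and "\<And>x. x \<in> Q \<Longrightarrow> m \<le> f x"
    and "Q \<in> sets lebesgue"
  shows "ereal m \<le> ess_inf_on Q f"
proof -
  have "esssup (lebesgue_on Q) (\<lambda>x. - ereal (f x)) \<le> ereal (- m)"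
    using assms by (intro esssup_I) (auto intro!: AE_I2)
  then show ?thesis
    unfolding ess_inf_on_def by (metis ereal_minus_le_minus ereal_uminus_uminus uminus_ereal.simps(1))
qed

text \<open>Off a null set the value of \<open>f\<close> lies between the two bounds; as \<open>A\<close> is not null, such a
  point exists.\<close>

lemma ess_inf_on_le_ess_sup_on:
  assumes "0 < measure lebesgue A" "A \<in> sets lebesgue"
  shows "ess_inf_on A f \<le> ess_sup_on A f"
proof (rule ccontr)
  let ?M = "lebesgue_on A"
  assume contra: "\<not> ess_inf_on A f \<le> ess_sup_on A f"
  have "AE x in ?M. ereal (f x) \<le> ess_sup_on A f" "AE x in ?M. - ereal (f x) \<le> - ess_inf_on A f"
    unfolding ess_sup_on_def ess_inf_on_def ereal_uminus_uminus by (rule esssup_AE)+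
  then have "AE x in ?M. False"
  proof eventually_elim
    case (elim x)
    then have "ess_inf_on A f \<le> ereal (f x)" by (simp only: ereal_minus_le_minus)
    with elim(1) contra show False by (meson order_trans)
  qed
  then have "emeasure ?M (space ?M) = 0"
    using ae_filter_eq_bot_iff[of ?M] by (simp add: trivial_limit_def)
  then show False
    using assms by (simp add: emeasure_restrict_space measure_def)
qed

text \<open>It is enough to bound the excess over \<open>Q\<close> in terms of the length of \<open>Q\<close> itself: the bound
  increases with the length, so it also holds for every \<open>r \<ge> \<bar>Q\<bar>\<close>.\<close>

lemma BLO_log_if_excess_bounded:
  assumes f: "f \<in> borel_measurable borel" "\<And>x. 0 \<le> f x" "\<And>x. f x \<le> 1" and C: "0 < C"
    and ex: "\<And>Q l. is_interval Q \<Longrightarrow> Q \<in> lmeasurable \<Longrightarrow> l = measure lebesgue Q \<Longrightarrow> 0 < l \<Longrightarrow> l \<le> 1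
      \<Longrightarrow> excess Q f \<le> C / ln (exp 1 + 1 / l)"
  shows "f \<in> BLO_log"
proof -
  have "integrable (lebesgue_on {0..1}) f"
    using set_integrable_lebesgue_bounded[of "{0..1}" f 1] f
    by (simp add: set_integrable_def integrable_restrict_space)
  moreover have "eta f r \<le> ereal (C / ln (exp 1 + 1 / r))" if r: "0 < r" "r \<le> 1" for r
    unfolding eta_def
  proof (rule SUP_least, clarify)
    fix Q :: "real set"
    assume iv: "is_interval Q" and sub: "Q \<subseteq> {0..1}"
      and pos: "0 < measure lebesgue Q" and le: "measure lebesgue Q \<le> r"
    define l where "l = measure lebesgue Q"
    have Q: "Q \<in> lmeasurable"
      using iv sub by (intro measurable_convex is_interval_convex bounded_subset[OF bounded_closed_interval])
    have "ereal (Inf (f ` Q)) \<le> ess_inf_on Q f"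
      using Q f by (intro ess_inf_on_ge cINF_lower bdd_belowI2[where m = 0] measurable_restrict_space1)
        (auto simp: measurable_completion)
    then have "ereal (mean_on Q f) - ess_inf_on Q f \<le> ereal (mean_on Q f) - ereal (Inf (f ` Q))"
      by (intro ereal_minus_mono order_refl)
    also have "\<dots> = ereal (excess Q f)" by (simp add: excess_def)
    also have "excess Q f \<le> C / ln (exp 1 + 1 / l)"
      using pos le r by (intro ex[OF iv Q l_def]) (auto simp: l_def)
    also have "\<dots> \<le> C / ln (exp 1 + 1 / r)"
    proof -
      have l: "0 < l" "l \<le> r" using pos le by (simp_all add: l_def)
      then have "1 / r \<le> 1 / l" by (intro divide_left_mono) auto
      moreover have "1 < exp (1::real)" "0 < 1 / r" using r by simp_all
      ultimately have *: "1 < exp 1 + 1 / r" "exp 1 + 1 / r \<le> exp 1 + 1 / l" by linarith+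
      then have "ln (exp 1 + 1 / r) \<le> ln (exp 1 + 1 / l)" by simp
      moreover have "0 < ln (exp 1 + 1 / r)" using *(1) by (rule ln_gt_zero)
      ultimately show ?thesis using C by (intro divide_left_mono) auto
    qed
    finally show "ereal (mean_on Q f) - ess_inf_on Q f \<le> ereal (C / ln (exp 1 + 1 / r))" by simp
  qed
  ultimately show ?thesis unfolding BLO_log_def using C by blast
qed

section \<open>Tents and spikes\<close>

definition tent :: "nat \<Rightarrow> real \<Rightarrow> real \<Rightarrow> real" where
  "tent j c x = min 1 (max 0 (2 - 2 ^ j * \<bar>x - c\<bar>))"

lemma tent_bounds: "0 \<le> tent j c x" "tent j c x \<le> 1"
  by (auto simp: tent_def)

lemma tent_measurable [measurable]: "tent j c \<in> borel_measurable borel"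
  unfolding tent_def[abs_def] by measurable

lemma tent_eq_0: "2 \<le> 2 ^ j * \<bar>x - c\<bar> \<Longrightarrow> tent j c x = 0"
  by (simp add: tent_def)

lemma tent_eq_1: "2 ^ j * \<bar>x - c\<bar> \<le> 1 \<Longrightarrow> tent j c x = 1"
  by (simp add: tent_def)

lemma tent_lipschitz: "tent j c x \<le> tent j c y + 2 ^ j * \<bar>x - y\<bar>"
proof -
  have lip: "min 1 (max 0 (2 - X)) \<le> min 1 (max 0 (2 - Y)) + D" if "Y \<le> X + D" "0 \<le> D"
    for X Y D :: real
    using that by (auto simp: min_def max_def)
  have "2 ^ j * \<bar>y - c\<bar> \<le> 2 ^ j * \<bar>x - c\<bar> + 2 ^ j * \<bar>x - y\<bar>"
    unfolding distrib_left[symmetric] by (intro mult_left_mono) auto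
  then show ?thesis unfolding tent_def by (intro lip) auto
qed

lemma interval_dist_le_measure:
  fixes Q :: "real set"
  assumes iv: "is_interval Q" and Q: "Q \<in> lmeasurable" and xy: "x \<in> Q" "y \<in> Q"
  shows "\<bar>x - y\<bar> \<le> measure lebesgue Q"
proof -
  have *: "v - u \<le> measure lebesgue Q" if "u \<in> Q" "v \<in> Q" "u \<le> v" for u v
  proof -
    have "{u..v} \<subseteq> Q"
    proof
      fix t assume "t \<in> {u..v}"
      then show "t \<in> Q" using mem_is_interval_1_I[OF iv that(1,2), of t] by simp
    qed
    then have "measure lebesgue {u..v} \<le> measure lebesgue Q"
      using Q by (intro measure_mono_fmeasurable) simp_all
    then show ?thesis using that(3) by simp
  qed
  show ?thesis using *[OF xy] *[OF xy(2,1)] by linarith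
qed

text \<open>The first bound, effective for short \<open>Q\<close>, is the slope of the tent times the length of
  \<open>Q\<close>. The second, effective for long \<open>Q\<close>, compares the mass of the tent with that length.\<close>

lemma excess_tent_le:
  assumes iv: "is_interval Q" and Q: "Q \<in> lmeasurable" and l: "l = measure lebesgue Q" "0 < l"
  shows "excess Q (tent j c) \<le> min (2 ^ j * l) (4 / (2 ^ j * l))"
proof -
  have ne: "Q \<noteq> {}" using l by (metis less_irrefl measure_empty)
  have int: "set_integrable lebesgue Q (tent j c)"
    by (rule set_integrable_lebesgue_bounded[OF Q, where B = 1]) (auto simp: tent_bounds)
  have "mean_on Q (tent j c) - 2 ^ j * l \<le> Inf (tent j c ` Q)"
  proof (rule cInf_greatest)
    fix v assume "v \<in> tent j c ` Q"
    then obtain y where y: "y \<in> Q" "v = tent j c y" by auto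
    have "mean_on Q (tent j c) \<le> mean_on Q (\<lambda>x. tent j c y + 2 ^ j * l)"
    proof (rule mean_on_mono[OF int])
      show "set_integrable lebesgue Q (\<lambda>x. tent j c y + 2 ^ j * l)"
        by (rule set_integrable_lebesgue_bounded[OF Q _ order_refl]) auto
      fix x assume "x \<in> Q"
      then have "2 ^ j * \<bar>x - y\<bar> \<le> 2 ^ j * l"
        using interval_dist_le_measure[OF iv Q _ y(1)] unfolding l(1) by (intro mult_left_mono) simp_all
      then show "tent j c x \<le> tent j c y + 2 ^ j * l"
        using tent_lipschitz[of j c x y] by linarith
    qed
    then show "mean_on Q (tent j c) - 2 ^ j * l \<le> v"
      using mean_on_const[OF Q] l(2)[unfolded l(1)] y(2) by simp
  qed (use ne in auto)
  moreover have "mean_on Q (tent j c) \<le> 4 / (2 ^ j * l)"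
  proof -
    let ?I = "{c - 2 / 2 ^ j..c + 2 / 2 ^ j}"
    have "(LINT x:Q|lebesgue. tent j c x) \<le> (LINT x|lebesgue. indicator ?I x)"
      unfolding set_lebesgue_integral_def
    proof (rule integral_mono)
      show "integrable lebesgue (\<lambda>x. indicat_real Q x *\<^sub>R tent j c x)"
        using int by (simp add: set_integrable_def)
      show "integrable lebesgue (indicat_real ?I)"
        by (rule integrable_real_indicator) (auto simp: emeasure_lborel_Icc_eq)
      fix x :: real
      have "tent j c x = 0" if "x \<notin> ?I"
      proof (rule tent_eq_0)
        have "2 / 2 ^ j \<le> \<bar>x - c\<bar>" using that by (auto simp: abs_if)
        then show "2 \<le> 2 ^ j * \<bar>x - c\<bar>" by (simp add: field_simps)
      qed
      then show "indicat_real Q x *\<^sub>R tent j c x \<le> indicator ?I x"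
        using tent_bounds[of j c x] by (auto simp: indicator_def)
    qed
    also have "\<dots> = 4 / 2 ^ j" by simp
    finally have "1 / l * (LINT x:Q|lebesgue. tent j c x) \<le> 1 / l * (4 / 2 ^ j)"
      using l(2) by (intro mult_left_mono) simp_all
    then show ?thesis
      unfolding mean_on_def l(1)[symmetric] by (simp add: mult.commute)
  qed
  moreover have "0 \<le> Inf (tent j c ` Q)"
    using ne by (intro cInf_greatest) (auto simp: tent_bounds)
  ultimately show ?thesis unfolding excess_def min_def by (simp split: if_splits; linarith)
qed

text \<open>A bounded increasing function whose increments under doubling dominate
  \<open>min u (4/u)\<close> up to a factor; it turns sums over doubling sequences into telescoping ones.\<close>

definition ramp :: "real \<Rightarrow> real" where
  "ramp u = u / (1 + u)"

text \<open>After division by \<open>min u (4/u)\<close> the claim is that \<open>(1 + 2u)(1 + u)\<close> is at most \<open>15\<close> for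
  \<open>u \<le> 2\<close> and at most \<open>15u\<^sup>2/4\<close> for \<open>u \<ge> 2\<close>; both are equalities at \<open>u = 2\<close>.\<close>

lemma min_le_ramp_diff:
  assumes "0 < u"
  shows "min u (4 / u) \<le> 15 * (ramp (2 * u) - ramp u)"
proof -
  have eq: "ramp (2 * u) - ramp u = u / ((1 + 2 * u) * (1 + u))"
    using assms by (simp add: ramp_def divide_simps) (simp add: algebra_simps)
  show ?thesis
  proof (cases "u \<le> 2")
    case True
    have "u * u \<le> 2 * 2" using True assms by (intro mult_mono) auto
    then have "(1 + 2 * u) * (1 + u) \<le> 15" using True by (simp add: algebra_simps)
    then have "u * ((1 + 2 * u) * (1 + u)) \<le> u * 15" using assms by (intro mult_left_mono) auto
    then have "u \<le> 15 * (u / ((1 + 2 * u) * (1 + u)))"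
      using assms by (simp add: pos_le_divide_eq mult.commute)
    then show ?thesis unfolding eq by simp
  next
    case False
    \<comment> \<open>The factorisation of \<open>15u\<^sup>2 - 4(1 + 2u)(1 + u)\<close>.\<close>
    have "0 \<le> (u - 2) * (7 * u + 2)" using False by simp
    then have "4 * ((1 + 2 * u) * (1 + u)) \<le> 15 * u * u" by (simp add: algebra_simps)
    then have "4 / u \<le> 15 * (u / ((1 + 2 * u) * (1 + u)))"
      using assms by (simp add: divide_simps ac_simps)
    then show ?thesis unfolding eq by simp
  qed
qed

lemma ramp_le_min:
  assumes "0 < u"
  shows "ramp u \<le> min 1 u"
proof -
  have "u / (1 + u) \<le> u / 1" using assms by (intro divide_left_mono) auto
  then show ?thesis using assms by (simp add: ramp_def)
qed

lemma sum_min_doubling_le: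
  assumes "0 < u"
  shows "(\<Sum>j<n. min (2 ^ j * u) (4 / (2 ^ j * u))) \<le> 15 * ramp (2 ^ n * u)"
proof -
  have "(\<Sum>j<n. min (2 ^ j * u) (4 / (2 ^ j * u)))
      \<le> (\<Sum>j<n. 15 * (ramp (2 ^ Suc j * u) - ramp (2 ^ j * u)))"
    using assms min_le_ramp_diff[of "2 ^ _ * u"] by (intro sum_mono) (simp add: mult.assoc)
  also have "\<dots> = 15 * (ramp (2 ^ n * u) - ramp u)"
    unfolding sum_distrib_left[symmetric]
    using sum_lessThan_telescope[of "\<lambda>j. ramp (2 ^ j * u)" n] by simp
  also have "\<dots> \<le> 15 * ramp (2 ^ n * u)" using assms by (simp add: ramp_def)
  finally show ?thesis .
qed

text \<open>A truncated logarithm: up to rounding, \<open>spike N x\<close> is \<open>log\<^sub>2(1/d)/N - 1\<close> clipped to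
  \<open>[0, 1]\<close>, where \<open>d\<close> is the distance of \<open>x\<close> from \<open>8/2\<^sup>N\<close>.\<close>

definition spike :: "nat \<Rightarrow> real \<Rightarrow> real" where
  "spike N x = (\<Sum>j = N..<2 * N. 1 / real N * tent j (8 / 2 ^ N) x)"

lemma spike_nonneg: "0 \<le> spike N x"
  unfolding spike_def by (intro sum_nonneg mult_nonneg_nonneg) (auto simp: tent_bounds)

lemma spike_le_1: "spike N x \<le> 1"
proof -
  have "spike N x \<le> (\<Sum>j = N..<2 * N. 1 / real N * 1)"
    unfolding spike_def by (intro sum_mono mult_left_mono tent_bounds) auto
  then show ?thesis by (cases "N = 0") auto
qed

lemma spike_measurable [measurable]: "spike N \<in> borel_measurable borel"
  unfolding spike_def[abs_def] by measurable

lemma spike_eq_1: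
  assumes "1 \<le> N" "\<bar>x - 8 / 2 ^ N\<bar> \<le> 1 / 4 ^ N"
  shows "spike N x = 1"
proof -
  have "tent j (8 / 2 ^ N) x = 1" if "j < 2 * N" for j
  proof (rule tent_eq_1)
    have "2 ^ j * \<bar>x - 8 / 2 ^ N\<bar> \<le> 2 ^ (2 * N) * (1 / 4 ^ N)"
      using that assms by (intro mult_mono power_increasing) auto
    then show "2 ^ j * \<bar>x - 8 / 2 ^ N\<bar> \<le> 1" by (simp add: power_mult)
  qed
  then show ?thesis using assms(1) by (simp add: spike_def)
qed

lemma spike_eq_0:
  assumes "x \<le> 6 / 2 ^ N \<or> 10 / 2 ^ N \<le> x"
  shows "spike N x = 0"
proof -
  have *: "2 / 2 ^ N \<le> \<bar>x - 8 / 2 ^ N\<bar>" using assms by (auto simp: abs_if field_simps)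
  have "tent j (8 / 2 ^ N) x = 0" if "N \<le> j" for j
  proof (rule tent_eq_0)
    have "2 ^ N * (2 / 2 ^ N) \<le> 2 ^ j * \<bar>x - 8 / 2 ^ N\<bar>"
      using that * by (intro mult_mono power_increasing) auto
    then show "2 \<le> 2 ^ j * \<bar>x - 8 / 2 ^ N\<bar>" by simp
  qed
  then show ?thesis by (simp add: spike_def)
qed

text \<open>The sum over \<open>j < 2N\<close> of the bounds for tents telescopes to a multiple of
  \<open>ramp (4\<^sup>Nl)\<close>.\<close>

lemma excess_spike_le:
  assumes "is_interval Q" "Q \<in> lmeasurable" "l = measure lebesgue Q" "0 < l" "1 \<le> N"
  shows "excess Q (spike N) \<le> 15 / N * min 1 (4 ^ N * l)"
proof -
  have "excess Q (spike N) \<le> (\<Sum>j = N..<2 * N. 1 / real N * excess Q (tent j (8 / 2 ^ N)))"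
    unfolding spike_def[abs_def] using assms
    by (intro excess_sum_le set_integrable_lebesgue_bounded[OF assms(2), where B = 1] bdd_belowI2[where m = 0])
      (auto simp: tent_bounds)
  also have "\<dots> \<le> (\<Sum>j = N..<2 * N. 1 / real N * min (2 ^ j * l) (4 / (2 ^ j * l)))"
    using assms by (intro sum_mono mult_left_mono excess_tent_le) auto
  also have "\<dots> \<le> 1 / real N * (\<Sum>j < 2 * N. min (2 ^ j * l) (4 / (2 ^ j * l)))"
    unfolding sum_distrib_left[symmetric] using assms(4)
    by (intro mult_left_mono sum_mono2) auto
  also have "\<dots> \<le> 1 / real N * (15 * ramp (4 ^ N * l))"
    using sum_min_doubling_le[OF assms(4), of "2 * N"]
    by (intro mult_left_mono) (auto simp: power_mult)
  also have "\<dots> \<le> 1 / real N * (15 * min 1 (4 ^ N * l))"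
    using assms(4) by (intro mult_left_mono ramp_le_min) auto
  finally show ?thesis by simp
qed

text \<open>For \<open>L \<le> 4N\<close> both sides are compared with \<open>1/N\<close>. For \<open>L > 4N\<close> the left-hand side is
  exponentially small in \<open>L\<close>, because \<open>l \<le> 4 exp (-L)\<close> while \<open>4\<^sup>N \<le> exp (2N) \<le> exp (L/2)\<close>. The
  right-hand side has the form for which sums over \<open>N = 2\<^sup>k\<close> telescope.\<close>

lemma capped_power_le_log:
  assumes l: "0 < l" "l \<le> 1" and N: "1 \<le> N" and L: "L = ln (exp 1 + 1 / l)"
  shows "1 / real N * min 1 (4 ^ N * l) \<le> 32 / L * min (N / L) (4 / (N / L))"
proof -
  have "exp L = exp 1 + 1 / l" using l by (simp add: L add_pos_pos)
  moreover have "exp 1 * l \<le> 3 * 1" using l exp_le by (intro mult_mono) auto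
  ultimately have le: "l \<le> 4 * exp (- L)"
    using l by (simp add: exp_minus field_simps)
  have L1: "1 \<le> L"
  proof -
    have "ln (exp 1) \<le> L" unfolding L using l by (subst ln_le_cancel_iff) (auto intro!: add_pos_pos)
    then show ?thesis by simp
  qed
  have second: "1 / real N * min 1 (4 ^ N * l) \<le> 32 / L * (4 / (N / L))"
  proof -
    have "1 / real N * min 1 (4 ^ N * l) \<le> 1 / real N * 1" by (intro mult_left_mono) auto
    also have "\<dots> \<le> 32 / L * (4 / (N / L))" using L1 N by (simp add: divide_simps)
    finally show ?thesis .
  qed
  have first: "1 / real N * min 1 (4 ^ N * l) \<le> 32 / L * (N / L)"
  proof (cases "L \<le> 4 * N")
    case True
    then have "L * L \<le> (4 * real N) * (4 * real N)" using L1 by (intro mult_mono) auto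
    moreover have "0 \<le> real N * real N" by simp
    ultimately have "L * L \<le> 32 * (real N * real N)" by linarith
    then have "1 / real N * 1 \<le> 32 / L * (N / L)"
      using L1 N by (simp add: divide_simps)
    moreover have "1 / real N * min 1 (4 ^ N * l) \<le> 1 / real N * 1" by (intro mult_left_mono) auto
    ultimately show ?thesis by linarith
  next
    case False
    have "(4::real) \<le> exp 2"
    proof -
      have "(2::real) * 2 \<le> exp 1 * exp 1" using exp_ge_add_one_self[of 1] by (intro mult_mono) auto
      then show ?thesis by (simp add: exp_add[symmetric])
    qed
    then have "4 ^ N \<le> exp (2::real) ^ N" by (intro power_mono) auto
    also have "\<dots> = exp (2 * real N)" by (simp add: exp_of_nat_mult[symmetric] mult.commute)
    also have "\<dots> \<le> exp (L / 2)" using False by simp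
    finally have "4 ^ N * l \<le> exp (L / 2) * (4 * exp (- L))"
      using le l by (intro mult_mono) auto
    also have "\<dots> = 4 * exp (- (L / 2))" by (simp add: exp_add[symmetric])
    also have "\<dots> \<le> 32 / (L * L)"
    proof -
      have "1 + L / 2 + (L / 2)\<^sup>2 / 2 \<le> exp (L / 2)"
        using L1 by (intro exp_lower_Taylor_quadratic) auto
      then have "L * L / 8 \<le> exp (L / 2)" using L1 by (simp add: power2_eq_square)
      then show ?thesis using L1 by (simp add: exp_minus field_simps)
    qed
    finally have "1 / real N * min 1 (4 ^ N * l) \<le> 1 / real N * (32 / (L * L))"
      by (intro mult_left_mono) auto
    also have "\<dots> \<le> N * (32 / (L * L))" using N L1 
      by (intro mult_right_mono) (auto simp: divide_le_eq intro: order_trans[of _ "real N"])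
    finally show ?thesis by (simp add: ac_simps)
  qed
  show ?thesis
  proof (cases "N / L \<le> 4 / (N / L)")
    case True
    then show ?thesis using first by (simp only: min_absorb1)
  next
    case False
    then have "4 / (N / L) \<le> N / L" by (simp only: not_le less_imp_le)
    then show ?thesis using second by (simp only: min_absorb2)
  qed
qed

section \<open>The sum of all spikes\<close>

text \<open>The interval \<open>[6/2\<^sup>N, 12/2\<^sup>N]\<close> contains the support \<open>[6/2\<^sup>N, 10/2\<^sup>N]\<close> of the spike
  number \<open>N\<close> and an adjacent gap of comparable length, so this gives both the disjointness of the
  supports and a place for testing the Hardy operator where the exponent is undisturbed.\<close>

lemma spike_eq_0_near_other:
  assumes "M \<noteq> N" "6 / 2 ^ N \<le> x" "x \<le> 12 / 2 ^ N"
  shows "spike M x = 0"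
proof (rule spike_eq_0)
  show "x \<le> 6 / 2 ^ M \<or> 10 / 2 ^ M \<le> x"
  proof (cases "M < N")
    case True
    then have "(2::real) ^ Suc M \<le> 2 ^ N" by (intro power_increasing) auto
    then have "12 / 2 ^ N \<le> 12 / (2::real) ^ Suc M" by (intro divide_left_mono) auto
    then show ?thesis using assms(3) by simp
  next
    case False
    then have "(2::real) ^ Suc N \<le> 2 ^ M" using assms(1) by (intro power_increasing) auto
    then have "10 / 2 ^ M \<le> 10 / (2::real) ^ Suc N" by (intro divide_left_mono) auto
    also have "\<dots> \<le> 6 / 2 ^ N" by (simp add: field_simps)
    finally show ?thesis using assms(2) by simp
  qed
qed

text \<open>Along the powers \<open>N = 2\<^sup>k\<close> the bounds \<open>O(1/N)\<close> for the spikes form a geometric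
  series; over all \<open>N\<close> they would form a divergent one.\<close>

definition bump :: "real \<Rightarrow> real" where
  "bump x = (\<Sum>k. spike (2 ^ k) x)"

text \<open>At each point at most one spike is nonzero, so the sum equals one of its terms.\<close>

lemma bump_cases:
  obtains k where "(\<lambda>i. spike (2 ^ i) x) sums spike (2 ^ k) x"
proof (cases "\<exists>k. spike (2 ^ k) x \<noteq> 0")
  case True
  then obtain k where k: "spike (2 ^ k) x \<noteq> 0" by blast
  then have x: "6 / 2 ^ (2 ^ k) \<le> x" "x \<le> 10 / 2 ^ (2 ^ k)"
    using spike_eq_0[of x "2 ^ k"] by force+
  have "x \<le> 12 / 2 ^ (2 ^ k)"
    by (rule order_trans[OF x(2)]) (simp add: divide_right_mono)
  then have "spike (2 ^ i) x = 0" if "i \<noteq> k" for i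
    using that x(1) by (intro spike_eq_0_near_other[of _ "2 ^ k"]) auto
  then show thesis using sums_finite[of "{k}" "\<lambda>i. spike (2 ^ i) x"] that by auto
next
  case False
  then have "(\<lambda>i. spike (2 ^ i) x) sums spike (2 ^ 0) x"
    by (metis (no_types, lifting) sums_0)
  then show thesis by (rule that)
qed

lemma bump_summable: "summable (\<lambda>k. spike (2 ^ k) x)"
  by (rule bump_cases[of x]) (rule sums_summable)

lemma bump_bounds: "0 \<le> bump x" "bump x \<le> 1"
proof -
  obtain k where "(\<lambda>i. spike (2 ^ i) x) sums spike (2 ^ k) x" by (rule bump_cases)
  then have "bump x = spike (2 ^ k) x" unfolding bump_def by (rule sums_unique[symmetric])
  then show "0 \<le> bump x" "bump x \<le> 1" by (simp_all add: spike_nonneg spike_le_1)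
qed

lemma bump_measurable [measurable]: "bump \<in> borel_measurable borel"
  unfolding bump_def[abs_def] by measurable

lemma bump_eq_1:
  assumes "\<bar>x - 8 / 2 ^ (2 ^ k)\<bar> \<le> 1 / 4 ^ (2 ^ k)"
  shows "bump x = 1"
proof -
  have "spike (2 ^ k) x = 1" using assms by (intro spike_eq_1) auto
  moreover have "spike (2 ^ k) x \<le> bump x"
    unfolding bump_def using sum_le_suminf[OF bump_summable, of "{k}" x] by (simp add: spike_nonneg)
  ultimately show ?thesis using bump_bounds(2)[of x] by simp
qed

lemma bump_eq_0:
  assumes "10 / 2 ^ (2 ^ k) \<le> x" "x \<le> 12 / 2 ^ (2 ^ k)"
  shows "bump x = 0"
proof -
  have "6 / 2 ^ (2 ^ k) \<le> x"
    by (rule order_trans[OF _ assms(1)]) (simp add: divide_right_mono)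
  then have "spike (2 ^ i) x = 0" for i
    using assms spike_eq_0[of x "2 ^ i"] spike_eq_0_near_other[of "2 ^ i" "2 ^ k" x]
    by (cases "i = k") auto
  then show ?thesis by (simp add: bump_def)
qed

text \<open>The second telescoping sum, now with \<open>u = 2\<^sup>k/L\<close>. The constant is \<open>15 \<cdot> 32 \<cdot> 15\<close>: a factor 15
  for each of the two sums and 32 from \<open>capped_power_le_log\<close>.\<close>

lemma excess_partial_bump_le:
  assumes "is_interval Q" "Q \<in> lmeasurable" "l = measure lebesgue Q" "0 < l" "l \<le> 1"
  shows "excess Q (\<lambda>x. \<Sum>k<n. spike (2 ^ k) x) \<le> 7200 / ln (exp 1 + 1 / l)"
proof -
  define L where "L = ln (exp 1 + 1 / l)"
  have "1 < exp (1::real)" "0 < 1 / l" using assms(4) by simp_all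
  then have "1 < exp 1 + 1 / l" by linarith
  then have L: "0 < L" unfolding L_def by (rule ln_gt_zero)
  have ne: "Q \<noteq> {}" using assms(3,4) by (metis less_irrefl measure_empty)
  have "excess Q (\<lambda>x. \<Sum>k<n. 1 * spike (2 ^ k) x) \<le> (\<Sum>k<n. 1 * excess Q (spike (2 ^ k)))"
    using ne by (intro excess_sum_le set_integrable_lebesgue_bounded[OF assms(2), where B = 1]
        bdd_belowI2[where m = 0]) (auto simp: spike_nonneg spike_le_1)
  also have "\<dots> \<le> (\<Sum>k<n. 15 * (32 / L * min (2 ^ k * (1 / L)) (4 / (2 ^ k * (1 / L)))))"
  proof (rule sum_mono)
    fix k
    have "excess Q (spike (2 ^ k)) \<le> 15 * (1 / real (2 ^ k) * min 1 (4 ^ (2 ^ k) * l))"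
      using excess_spike_le[OF assms(1-4), of "2 ^ k"] by simp
    also have "\<dots> \<le> 15 * (32 / L * min (real (2 ^ k) / L) (4 / (real (2 ^ k) / L)))"
      using capped_power_le_log[OF assms(4,5) _ L_def, of "2 ^ k"] by (intro mult_left_mono) auto
    finally show "1 * excess Q (spike (2 ^ k))
        \<le> 15 * (32 / L * min (2 ^ k * (1 / L)) (4 / (2 ^ k * (1 / L))))" by simp
  qed
  also have "\<dots> = 480 / L * (\<Sum>k<n. min (2 ^ k * (1 / L)) (4 / (2 ^ k * (1 / L))))"
    by (simp add: sum_distrib_left)
  also have "\<dots> \<le> 480 / L * 15"
  proof (rule mult_left_mono)
    have "ramp (2 ^ n * (1 / L)) \<le> 1" using ramp_le_min[of "2 ^ n * (1 / L)"] L by simp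
    then show "(\<Sum>k<n. min (2 ^ k * (1 / L)) (4 / (2 ^ k * (1 / L)))) \<le> 15"
      using sum_min_doubling_le[of "1 / L" n] L by simp
  qed (use L in simp)
  finally show ?thesis by (simp add: L_def)
qed

text \<open>The bound for partial sums does not depend on their length. Their infima are at most that of
  \<open>bump\<close>, and their means converge to that of \<open>bump\<close> by dominated convergence.\<close>

lemma excess_bump_le:
  assumes "is_interval Q" "Q \<in> lmeasurable" "l = measure lebesgue Q" "0 < l" "l \<le> 1"
  shows "excess Q bump \<le> 7200 / ln (exp 1 + 1 / l)"
proof -
  let ?P = "\<lambda>(n::nat) x. \<Sum>k<n. spike (2 ^ k) x"
  have ne: "Q \<noteq> {}" using assms(3,4) by (metis less_irrefl measure_empty)
  have P_le: "?P n x \<le> bump x" for n x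
    unfolding bump_def by (intro sum_le_suminf bump_summable) (auto simp: spike_nonneg)
  have P_ge: "0 \<le> ?P n x" for n x by (intro sum_nonneg spike_nonneg)
  have "mean_on Q (?P n) \<le> Inf (bump ` Q) + 7200 / ln (exp 1 + 1 / l)" for n
  proof -
    have "Inf (?P n ` Q) \<le> Inf (bump ` Q)"
      using ne by (intro cINF_mono bdd_belowI2[where m = 0]) (auto intro: P_le P_ge)
    then show ?thesis
      using excess_partial_bump_le[OF assms, of n] unfolding excess_def by linarith
  qed
  moreover have "(\<lambda>n. mean_on Q (?P n)) \<longlonglongrightarrow> mean_on Q bump"
    unfolding mean_on_def set_lebesgue_integral_def
  proof (intro tendsto_mult_left integral_dominated_convergence[where w = "indicat_real Q"] AE_I2)
    have Q: "Q \<in> sets lebesgue" using assms(2) by auto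
    show "(\<lambda>x. indicat_real Q x *\<^sub>R bump x) \<in> borel_measurable lebesgue"
      using Q bump_measurable
      by (intro borel_measurable_scaleR borel_measurable_indicator) (simp_all add: measurable_completion)
    show "(\<lambda>x. indicat_real Q x *\<^sub>R ?P n x) \<in> borel_measurable lebesgue" for n
      using Q by (intro borel_measurable_scaleR borel_measurable_indicator) 
        (simp_all add: measurable_completion)
    show "integrable lebesgue (indicat_real Q)"
      using assms(2) by (intro integrable_real_indicator) (auto simp: fmeasurable_def)
    show "(\<lambda>n. indicat_real Q x *\<^sub>R ?P n x) \<longlonglongrightarrow> indicat_real Q x *\<^sub>R bump x" for x
      unfolding bump_def by (intro tendsto_scaleR tendsto_const summable_LIMSEQ bump_summable)
    show "norm (indicat_real Q x *\<^sub>R ?P n x) \<le> indicat_real Q x" for n x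
      using P_le[where n = n and x = x] P_ge[where n = n and x = x] bump_bounds(2)[of x] by (auto simp: indicator_def)
  qed
  ultimately have "mean_on Q bump \<le> Inf (bump ` Q) + 7200 / ln (exp 1 + 1 / l)"
    by (intro LIMSEQ_le_const2[where X = "\<lambda>n. mean_on Q (?P n)"]) auto
  then show ?thesis by (simp add: excess_def)
qed

lemma excess_affine_bump_le:
  assumes "is_interval Q" "Q \<in> lmeasurable" "l = measure lebesgue Q" "0 < l" "l \<le> 1"
  shows "excess Q (\<lambda>x. 1 / 4 + bump x / 2) \<le> 3600 / ln (exp 1 + 1 / l)"
proof -
  have ne: "Q \<noteq> {}" using assms(3,4) by (metis less_irrefl measure_empty)
  have int: "set_integrable lebesgue Q bump" 
    by (rule set_integrable_lebesgue_bounded[OF assms(2), where B = 1]) (auto simp: bump_bounds)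
  have const: "set_integrable lebesgue Q (\<lambda>x. 1 / 4 :: real)"
    by (rule set_integrable_lebesgue_bounded[OF assms(2) _ order_refl]) auto
  have "mean_on Q (\<lambda>x. 1 / 4 + 1 / 2 * bump x) = mean_on Q (\<lambda>x. 1 / 4) + mean_on Q (\<lambda>x. 1 / 2 * bump x)"
    by (rule mean_on_add[OF const]) (use int in simp)
  then have "mean_on Q (\<lambda>x. 1 / 4 + 1 / 2 * bump x) = 1 / 4 + 1 / 2 * mean_on Q bump"
    using mean_on_const[OF assms(2), of "1 / 4"] assms(3,4) mean_on_cmult[of Q "1 / 2" bump] by argo
  moreover have "1 / 4 + 1 / 2 * Inf (bump ` Q) \<le> Inf ((\<lambda>x. 1 / 4 + 1 / 2 * bump x) ` Q)"
    using ne by (intro cInf_greatest)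
      (auto intro!: mult_left_mono cInf_lower bdd_belowI2[where m = 0] bump_bounds)
  ultimately have "excess Q (\<lambda>x. 1 / 4 + 1 / 2 * bump x) \<le> 1 / 2 * excess Q bump"
    by (simp add: excess_def)
  then show ?thesis using excess_bump_le[OF assms] by simp
qed

section \<open>Norm gaps for the Hardy operator\<close>

lemma set_integral_lebesgue_indicator:
  "(LINT t:{0..x}|lebesgue. indicat_real {a..b} t) = measure lebesgue ({0..x} \<inter> {a..b})"
  unfolding set_lebesgue_integral_def
  by (simp add: indicator_inter_arith[symmetric] del: Int_atLeastAtMost)

lemma hardy_indicator_bounds:
  "0 \<le> hardy (indicat_real {a..b}) x \<and> hardy (indicat_real {a..b}) x \<le> 1" if "0 \<le> x"
proof -
  have "measure lebesgue ({0..x} \<inter> {a..b}) \<le> measure lebesgue {0..x}"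
    by (intro measure_mono_fmeasurable) auto
  also have "\<dots> = x" using that by simp
  finally show ?thesis
    using that unfolding hardy_def set_integral_lebesgue_indicator
    by (cases "x = 0") (auto simp: divide_simps)
qed

lemma hardy_indicator_eq:
  assumes "0 \<le> a" "a \<le> b" "b \<le> x"
  shows "hardy (indicat_real {a..b}) x = (b - a) / x"
proof -
  have "{0..x} \<inter> {a..b} = {a..b}" using assms by auto
  then show ?thesis
    using assms unfolding hardy_def set_integral_lebesgue_indicator by simp
qed

lemma Lp_modular_bounds:
  assumes J: "J \<in> sets lebesgue"
  shows "(\<And>x. x \<in> {0..1} \<Longrightarrow> (\<bar>f x\<bar> / l) powr p x \<le> a * indicator J x) \<Longrightarrow> 0 \<le> a
           \<Longrightarrow> Lp_modular p f l \<le> ennreal a * emeasure lebesgue J"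
    and "(\<And>x. x \<in> J \<Longrightarrow> a \<le> (\<bar>f x\<bar> / l) powr p x) \<Longrightarrow> J \<subseteq> {0..1}
           \<Longrightarrow> ennreal a * emeasure lebesgue J \<le> Lp_modular p f l"
proof -
  have eq: "Lp_modular p f l
      = (\<integral>\<^sup>+x. ennreal ((\<bar>f x\<bar> / l) powr p x) * indicator {0..1} x \<partial>lebesgue)"
    unfolding Lp_modular_def by (rule nn_integral_restrict_space) simp
  have J': "ennreal a * emeasure lebesgue J = (\<integral>\<^sup>+x. ennreal a * indicator J x \<partial>lebesgue)"
    using J by (simp add: nn_integral_cmult_indicator)
  show "Lp_modular p f l \<le> ennreal a * emeasure lebesgue J"
    if "\<And>x. x \<in> {0..1} \<Longrightarrow> (\<bar>f x\<bar> / l) powr p x \<le> a * indicator J x" "0 \<le> a"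
    unfolding eq J'
  proof (rule nn_integral_mono)
    fix x
    show "ennreal ((\<bar>f x\<bar> / l) powr p x) * indicator {0..1} x \<le> ennreal a * indicator J x"
      using that(1)[of x] that(2)
      by (cases "x \<in> J"; cases "x \<in> {0..1}") (auto simp: ennreal_leI)
  qed
  show "ennreal a * emeasure lebesgue J \<le> Lp_modular p f l"
    if "\<And>x. x \<in> J \<Longrightarrow> a \<le> (\<bar>f x\<bar> / l) powr p x" "J \<subseteq> {0..1}"
    unfolding eq J'
  proof (rule nn_integral_mono)
    fix x
    show "ennreal a * indicator J x \<le> ennreal ((\<bar>f x\<bar> / l) powr p x) * indicator {0..1} x"
      using that(1)[of x] that(2) by (cases "x \<in> J") (auto simp: ennreal_leI)
  qed
qed

text \<open>The average of the indicator over \<open>[0, x]\<close> for \<open>x\<close> in \<open>[5y, 6y]\<close> is at least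
  \<open>(y\<^sup>2/2)/(6y) = y/12\<close>. Concentrating the mass where the exponent is \<open>4/3\<close> makes it cheap:
  for a constant exponent \<open>q\<close> on both intervals the norms would compare like \<open>y\<^bsup>2/q\<^esup>\<close> and
  \<open>y\<^bsup>1 + 1/q\<^esup>\<close>, and \<open>2/q \<le> 1 + 1/q\<close>
  leaves no gap.\<close>

lemma hardy_norm_gap:
  assumes y: "0 < y" "y \<le> 1 / 6"
    and p0: "\<And>x. x \<in> {0..1} \<Longrightarrow> 0 \<le> p x"
    and low: "\<And>x. \<bar>x - 4 * y\<bar> \<le> y\<^sup>2 / 4 \<Longrightarrow> p x = 4 / 3"
    and high: "\<And>x. 5 * y \<le> x \<Longrightarrow> x \<le> 6 * y \<Longrightarrow> p x = 4"
  shows "\<exists>f\<in>Lp_space p. 0 \<le> Lp_norm p f \<and> Lp_norm p f \<le> y powr (3 / 2) \<and> y powr (5 / 4) / 12 \<le> Lp_norm p (hardy f)"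
proof -
  define w where "w = y\<^sup>2 / 4"
  define I where "I = {4 * y - w..4 * y + w}"
  define f where "f = indicat_real I"
  have w: "0 < w" "w \<le> y"
  proof -
    have "y * y \<le> 1 * y" using y by (intro mult_right_mono) auto
    then show "w \<le> y" "0 < w" using y by (simp_all add: w_def power2_eq_square)
  qed
  have modf: "Lp_modular p f (y powr (3 / 2)) \<le> 1"
  proof -
    have "Lp_modular p f (y powr (3 / 2)) \<le> ennreal (1 / y\<^sup>2) * emeasure lebesgue I"
    proof (rule Lp_modular_bounds(1))
      fix x :: real
      show "(\<bar>f x\<bar> / y powr (3 / 2)) powr p x \<le> 1 / y\<^sup>2 * indicator I x"
      proof (cases "x \<in> I")
        case True
        then have "\<bar>x - 4 * y\<bar> \<le> w" unfolding I_def by (intro abs_leI) simp_all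
        then have "p x = 4 / 3" unfolding w_def by (rule low)
        moreover have "(1 / y powr (3 / 2)) powr (4 / 3) = 1 / y\<^sup>2"
          using y by (simp add: powr_divide powr_powr)
        moreover have "(\<bar>f x\<bar> / y powr (3 / 2)) powr p x = (1 / y powr (3 / 2)) powr p x"
          "1 / y\<^sup>2 * indicator I x = 1 / y\<^sup>2"
          using True by (simp_all add: f_def)
        ultimately show ?thesis by (simp only: order_refl)
      qed (simp add: f_def)
    qed (simp_all add: I_def)
    also have "\<dots> = ennreal (1 / y\<^sup>2 * (2 * w))"
    proof -
      have "emeasure lebesgue I = ennreal (2 * w)"
        using w(1) by (simp add: I_def emeasure_lborel_Icc_eq)
      then show ?thesis using w(1) ennreal_mult[of "1 / y\<^sup>2" "2 * w"] by (simp only:) simp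
    qed
    also have "1 / y\<^sup>2 * (2 * w) = 1 / 2" using y by (simp add: w_def)
    also have "ennreal (1 / 2) \<le> 1" by (subst ennreal_le_1) simp
    finally show ?thesis .
  qed
  have fLp: "f \<in> Lp_space p"
    unfolding Lp_space_def
  proof (intro CollectI conjI exI[of _ "y powr (3 / 2)"])
    show "f \<in> borel_measurable (lebesgue_on {0..1})"
      unfolding f_def I_def by (intro measurable_restrict_space1 borel_measurable_indicator) auto
    show "Lp_modular p f (y powr (3 / 2)) < \<infinity>" using modf by (rule le_less_trans) simp
  qed (use y in simp)
  have normf: "Lp_norm p f \<le> y powr (3 / 2)"
    unfolding Lp_norm_def using modf y
    by (intro cInf_lower bdd_belowI[where m = 0]) auto
  have normf0: "0 \<le> Lp_norm p f"
    unfolding Lp_norm_def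
  proof (rule cInf_greatest)
    have "y powr (3 / 2) \<in> {l. 0 < l \<and> Lp_modular p f l \<le> 1}" using modf y by simp
    then show "{l. 0 < l \<and> Lp_modular p f l \<le> 1} \<noteq> {}" by blast
  qed simp
  have "y powr (5 / 4) / 12 \<le> Lp_norm p (hardy f)"
    unfolding Lp_norm_def
  proof (rule cInf_greatest)
    \<comment> \<open>An infimum over the empty set would carry no information, so some admissible \<open>l\<close> is
      needed; \<open>l = 1\<close> works because averages of an indicator lie between 0 and 1.\<close>
    have "Lp_modular p (hardy f) 1 \<le> ennreal 1 * emeasure lebesgue {0..1::real}"
    proof (rule Lp_modular_bounds(1))
      fix x :: real assume x: "x \<in> {0..1}"
      then show "(\<bar>hardy f x\<bar> / 1) powr p x \<le> 1 * indicator {0..1} x"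
        using hardy_indicator_bounds[of x "4 * y - w" "4 * y + w"] p0[OF x]
        unfolding f_def I_def by (simp add: powr_le1)
    qed auto
    then have "Lp_modular p (hardy f) 1 \<le> 1" by simp
    then have "1 \<in> {l. 0 < l \<and> Lp_modular p (hardy f) l \<le> 1}" by simp
    then show "{l. 0 < l \<and> Lp_modular p (hardy f) l \<le> 1} \<noteq> {}" by blast
    fix l assume "l \<in> {l. 0 < l \<and> Lp_modular p (hardy f) l \<le> 1}"
    then have l: "0 < l" and mod: "Lp_modular p (hardy f) l \<le> 1" by auto
    let ?J = "{5 * y..6 * y}"
    have "ennreal ((y / 12 / l) powr 4) * emeasure lebesgue ?J \<le> Lp_modular p (hardy f) l"
    proof (rule Lp_modular_bounds(2))
      fix x assume x: "x \<in> ?J"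
      have "hardy f x = 2 * w / x"
        unfolding f_def I_def using x w y by (subst hardy_indicator_eq) auto
      moreover have "y / 12 \<le> 2 * w / x"
      proof -
        have "2 * w / (6 * y) \<le> 2 * w / x" using x w y by (intro divide_left_mono) auto
        moreover have "2 * w / (6 * y) = y / 12" using y by (simp add: w_def power2_eq_square)
        ultimately show ?thesis by simp
      qed
      ultimately have "y / 12 \<le> \<bar>hardy f x\<bar>" by linarith
      then have "y / 12 / l \<le> \<bar>hardy f x\<bar> / l"
        using l by (intro divide_right_mono) simp_all
      then have "(y / 12 / l) powr 4 \<le> (\<bar>hardy f x\<bar> / l) powr 4"
        using y l by (intro powr_mono2) auto
      then show "(y / 12 / l) powr 4 \<le> (\<bar>hardy f x\<bar> / l) powr p x"
        using high[of x] x by simp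
    qed (use y in auto)
    also have "emeasure lebesgue ?J = ennreal y"
      using y by (simp add: emeasure_lborel_Icc_eq)
    finally have "ennreal ((y / 12 / l) powr 4 * y) \<le> 1"
      using mod y by (simp add: ennreal_mult'')
    then have "(y / 12 / l) powr 4 * y \<le> 1" by (simp add: ennreal_le_1)
    then have "((y / 12 / l) powr 4 * y) powr (1 / 4) \<le> 1 powr (1 / 4)"
      using y by (intro powr_mono2) auto
    moreover have "((y / 12 / l) powr 4) powr (1 / 4) = y / 12 / l"
      unfolding powr_powr using y l by simp
    moreover have "((y / 12 / l) powr 4 * y) powr (1 / 4)
        = ((y / 12 / l) powr 4) powr (1 / 4) * y powr (1 / 4)"
      by (rule powr_mult)
    ultimately have "y / 12 / l * y powr (1 / 4) \<le> 1" by (simp only: powr_one_eq_one)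
    moreover have "y powr (5 / 4) = y * y powr (1 / 4)"
      using y powr_add[of y 1 "1 / 4"] by simp
    ultimately show "y powr (5 / 4) / 12 \<le> l" using l by (simp add: field_simps)
  qed
  with fLp normf normf0 show ?thesis by blast
qed

text \<open>The ratio of the two norms in \<open>hardy_norm_gap\<close> is at least \<open>y\<^bsup>-1/4\<^esup>/12\<close>.\<close>

lemma not_bounded_hardy_if_norm_gaps:
  assumes p0: "\<And>x. x \<in> {0..1} \<Longrightarrow> 0 \<le> p x"
    and y: "\<And>k. 0 < y k" "y \<longlonglongrightarrow> 0"
    and low: "\<And>k x. \<bar>x - 4 * y k\<bar> \<le> (y k)\<^sup>2 / 4 \<Longrightarrow> p x = 4 / 3"
    and high: "\<And>k x. 5 * y k \<le> x \<Longrightarrow> x \<le> 6 * y k \<Longrightarrow> p x = 4"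
  shows "\<not> bounded_in_Lp p hardy"
proof
  assume "bounded_in_Lp p hardy"
  then obtain C where C: "\<And>f. f \<in> Lp_space p \<Longrightarrow> Lp_norm p (hardy f) \<le> C * Lp_norm p f"
    unfolding bounded_in_Lp_def by blast
  have "(\<lambda>k. 12 * \<bar>C\<bar> * y k powr (1 / 4)) \<longlonglongrightarrow> 12 * \<bar>C\<bar> * 0 powr (1 / 4)"
  proof (intro tendsto_mult tendsto_const tendsto_powr')
    show "y \<longlonglongrightarrow> 0" by (rule y(2))
    have "0 \<le> y k" for k using y(1)[of k] by simp
    then show "0 \<noteq> (0::real) \<or> (0 < (1 / 4 :: real) \<and> (\<forall>\<^sub>F k in sequentially. 0 \<le> y k))" by simp
  qed
  then have "\<forall>\<^sub>F k in sequentially. 12 * \<bar>C\<bar> * y k powr (1 / 4) < 1"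
    by (intro order_tendstoD) auto
  moreover have "\<forall>\<^sub>F k in sequentially. y k < 1 / 6"
    using y(2) by (rule order_tendstoD) simp
  ultimately have "\<forall>\<^sub>F k in sequentially. 12 * \<bar>C\<bar> * y k powr (1 / 4) < 1 \<and> y k < 1 / 6"
    by (rule eventually_conj)
  then obtain k where k: "12 * \<bar>C\<bar> * y k powr (1 / 4) < 1" "y k < 1 / 6"
    by (auto dest: eventually_happens)
  obtain f where f: "f \<in> Lp_space p" and nonneg: "0 \<le> Lp_norm p f"
    and upper: "Lp_norm p f \<le> y k powr (3 / 2)"
    and lower: "y k powr (5 / 4) / 12 \<le> Lp_norm p (hardy f)"
  proof -
    have "\<exists>f\<in>Lp_space p. 0 \<le> Lp_norm p f \<and> Lp_norm p f \<le> y k powr (3 / 2)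
        \<and> y k powr (5 / 4) / 12 \<le> Lp_norm p (hardy f)"
    proof (rule hardy_norm_gap)
      show "0 < y k" by (rule y(1))
      show "y k \<le> 1 / 6" using k(2) by simp
      show "0 \<le> p x" if "x \<in> {0..1}" for x using that by (rule p0)
      show "p x = 4 / 3" if "\<bar>x - 4 * y k\<bar> \<le> (y k)\<^sup>2 / 4" for x using that by (rule low)
      show "p x = 4" if "5 * y k \<le> x" "x \<le> 6 * y k" for x using that by (rule high)
    qed
    then show thesis using that by blast
  qed
  have "y k powr (5 / 4) / 12 \<le> \<bar>C\<bar> * y k powr (3 / 2)"
  proof -
    have "C * Lp_norm p f \<le> \<bar>C\<bar> * Lp_norm p f" using nonneg by (intro mult_right_mono) auto
    also have "\<dots> \<le> \<bar>C\<bar> * y k powr (3 / 2)" using upper by (intro mult_left_mono) auto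
    finally show ?thesis using lower C[OF f] by linarith
  qed
  also have "y k powr (3 / 2) = y k powr (1 / 4) * y k powr (5 / 4)"
    by (simp add: powr_add[symmetric])
  finally have "y k powr (5 / 4) * 1 \<le> y k powr (5 / 4) * (12 * \<bar>C\<bar> * y k powr (1 / 4))"
    by (simp add: ac_simps)
  then show False using k(1) y(1)[of k] by simp
qed

section \<open>The counterexample\<close>

theorem theorem1p5:
  shows "\<exists>p :: real \<Rightarrow> real. exponent p
    \<and> 1 < ess_inf_on {0..1} p
    \<and> ess_inf_on {0..1} p \<le> ess_sup_on {0..1} p
    \<and> ess_sup_on {0..1} p < \<infinity>
    \<and> (\<lambda>x. 1 / p x) \<in> BLO_log
    \<and> \<not> bounded_in_Lp p hardy"
proof (intro exI conjI)
  define p where "p x = 1 / (1 / 4 + bump x / 2)" for x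
  have p_bounds: "4 / 3 \<le> p x" "p x \<le> 4" for x
    using bump_bounds[of x] by (simp_all add: p_def field_simps)
  have p_meas: "p \<in> borel_measurable (lebesgue_on {0..1})"
  proof (rule measurable_restrict_space1)
    have "p \<in> borel_measurable borel" unfolding p_def[abs_def] by measurable
    then show "p \<in> borel_measurable lebesgue" by (simp add: measurable_completion)
  qed
  have "1 \<le> p x" for x using p_bounds(1)[of x] by linarith
  then show "exponent p" unfolding exponent_def using p_meas by simp
  have "ereal (4 / 3) \<le> ess_inf_on {0..1} p"
    using p_meas p_bounds by (intro ess_inf_on_ge) auto
  then show "1 < ess_inf_on {0..1} p" by (rule less_le_trans[rotated]) simp
  show "ess_inf_on {0..1} p \<le> ess_sup_on {0..1} p"
    by (rule ess_inf_on_le_ess_sup_on) auto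
  have "ess_sup_on {0..1} p \<le> ereal 4"
    unfolding ess_sup_on_def using p_meas p_bounds by (intro esssup_I) auto
  then show "ess_sup_on {0..1} p < \<infinity>" by (rule le_less_trans) simp
  have "(\<lambda>x. 1 / 4 + bump x / 2) \<in> BLO_log"
  proof (rule BLO_log_if_excess_bounded[OF _ _ _ _ excess_affine_bump_le])
    show "0 \<le> 1 / 4 + bump x / 2" "1 / 4 + bump x / 2 \<le> 1" for x
      using bump_bounds[of x] by simp_all
  qed simp_all
  then show "(\<lambda>x. 1 / p x) \<in> BLO_log" by (simp add: p_def)
  \<comment> \<open>Chosen such that the dip number \<open>k\<close> is centred at \<open>4 y k\<close> and has half-width
    \<open>(y k)\<^sup>2/4\<close>.\<close>
  define y :: "nat \<Rightarrow> real" where "y k = 2 / 2 ^ (2 ^ k)" for k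
  show "\<not> bounded_in_Lp p hardy"
  proof (rule not_bounded_hardy_if_norm_gaps)
    show "0 \<le> p x" for x using p_bounds(1)[of x] by simp
    show "0 < y k" for k by (simp add: y_def)
    have "(\<lambda>n. 2 * (1 / 2) ^ n :: real) \<longlonglongrightarrow> 2 * 0"
      by (intro tendsto_intros LIMSEQ_power_zero) simp
    then have "((\<lambda>n. 2 * (1 / 2) ^ n :: real) \<circ> (\<lambda>k. 2 ^ k)) \<longlonglongrightarrow> 2 * 0"
      by (rule LIMSEQ_subseq_LIMSEQ) (simp add: strict_mono_def)
    then show "y \<longlonglongrightarrow> 0" by (simp add: y_def[abs_def] o_def power_divide)
    show "p x = 4 / 3" if "\<bar>x - 4 * y k\<bar> \<le> (y k)\<^sup>2 / 4" for k x
    proof -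
      have "(y k)\<^sup>2 / 4 = 1 / 4 ^ (2 ^ k)"
        by (simp add: y_def power_divide power_mult[symmetric] mult.commute[of _ 2]) (simp add: power_mult)
      then have "bump x = 1" using that by (intro bump_eq_1[of x k]) (simp add: y_def)
      then show ?thesis by (simp add: p_def)
    qed
    show "p x = 4" if "5 * y k \<le> x" "x \<le> 6 * y k" for k x
      using that bump_eq_0[of k x] by (simp add: p_def y_def)
  qed
qed

end
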